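(* Let $H$ be a real Hilbert space, $K\ge 2$, and let $A_1,\dots,A_K\subset H$ be closed convex sets with $A_1\cap\dots\cap A_K=\{0\}$. Let $i(n)\in\{1,\dots,K\}$, $n=1,2,\dots$, be a sequence containing each $k\in\{1,\dots,K\}$ infinitely often, let $x_0\in H$, let $x_n=P_{i(n)}x_{n-1}$ for $n\ge 1$, and let $W$ be the set of all partial weak limits of $\{x_n\}$. Assume that zero is a weak internal point of each of the sets $A_k$, that is, for every $k\in\{1,\dots,K\}$ and every $a\in A_k$ there is $\lambda=\lambda(a,k)>0$ with $-\lambda a\in A_k$. Then $W=\{0\}$. In particular, if all $A_k$ are closed linear subspaces of $H$, then the sequence $\{x_n\}$ converges weakly.
   Context: $P_i$ denotes the metric (nearest point) projection of $H$ onto $A_i$. A partial weak limit of $\{x_n\}$ is the weak limit of some subsequence of $\{x_n\}$. *)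

theory Defs
  imports "HOL-Analysis.Analysis"
begin

(* The library's closest_point is restricted to the class heine_borel, which among
   normed spaces means finite dimension, so it cannot be used in a general Hilbert
   space.  For a nonempty closed convex S in a complete inner product space the
   nearest point exists and is unique, hence the use of THE. *)
definition metric_projection :: "'a::metric_space set \<Rightarrow> 'a \<Rightarrow> 'a" where
  "metric_projection S x = (THE p. p \<in> S \<and> (\<forall>q\<in>S. dist x p \<le> dist x q))"

definition weakly_converges_to :: "(nat \<Rightarrow> 'a::real_normed_vector) \<Rightarrow> 'a \<Rightarrow> bool" where
  "weakly_converges_to x l \<longleftrightarrow>
     (\<forall>f :: 'a \<Rightarrow> real. bounded_linear f \<longrightarrow> (\<lambda>n. f (x n)) \<longlonglongrightarrow> f l)"

definition partial_weak_limits :: "(nat \<Rightarrow> 'a::real_normed_vector) \<Rightarrow> 'a set" where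
  "partial_weak_limits x = {w. \<exists>r. strict_mono r \<and> weakly_converges_to (x \<circ> r) w}"

(* Used only for sets containing 0. *)
definition zero_weak_internal :: "'a::real_vector set \<Rightarrow> bool" where
  "zero_weak_internal S \<longleftrightarrow> (\<forall>a\<in>S. \<exists>c>0. - (c *\<^sub>R a) \<in> S)"

end

theory Submission
  imports Defs
begin

text \<open>The norms of the iterates decrease, because every set contains 0, and the drop of the squared
  norm in a step bounds the squared length of the step; hence the steps tend to 0. By weak compactness
  partial weak limits exist, and the point is to show that each of them lies in every \<open>A k\<close>.

  Call \<open>k\<close> active at \<open>w\<close> if \<open>w \<in> A k\<close>, and among all partial weak limits choose \<open>w\<close> with the fewest
  active indices. Suppose some index is inactive at \<open>w\<close>. Each inactive set is separated from \<open>w\<close>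
  by a hyperplane. An iterate weakly close to \<open>w\<close> is on the side of \<open>w\<close> of all these finitely many
  hyperplanes, but a later iterate is not, since inactive sets are visited again and again. Up to the
  first passage through a hyperplane only active sets are used. A weak limit \<open>v\<close> of the positions just
  before this passage is on or before every hyperplane, so nothing inactive at \<open>w\<close> is active at \<open>v\<close>;
  by minimality \<open>v\<close> and \<open>w\<close> have the same active indices. It is also on one of the hyperplanes, because
  the steps tend to 0; hence \<open>v \<noteq> w\<close> (\<open>partial_weak_limit_exit\<close>).

  On the other hand, projections do not increase the distance to a common point \<open>z\<close> of the sets
  used, nor to \<open>- c z\<close>, which for some \<open>c > 0\<close> also is a common point because 0 is weakly internal.
  As the norms converge, in the limit these two inequalities become \<open>\<langle>w, z\<rangle> \<le> \<langle>v, z\<rangle>\<close>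
  and its reverse (\<open>block_inner_eq\<close>). Taking \<open>z = v\<close> and \<open>z = w\<close> gives \<open>\<parallel>v - w\<parallel> = 0\<close>,
  a contradiction. So everything is active at \<open>w\<close>, by the choice of \<open>w\<close> also at every other partial
  weak limit, and 0 is the only common point of the sets.

  A bounded sequence with a unique partial weak limit converges weakly to it; this gives the
  assertion about subspaces.\<close>

section \<open>Nearest points of closed convex sets\<close>

text \<open>By the parallelogram law, near-minimizers of the distance to a convex set are close to one
  another, so they shrink to a point by completeness.\<close>
lemma nearest_point_exists:
  fixes S :: "'a::{real_inner, complete_space} set"
  assumes "closed S" "convex S" "S \<noteq> {}"
  shows "\<exists>p\<in>S. \<forall>q\<in>S. dist x p \<le> dist x q"
proof -
  define D where "D = (INF q\<in>S. (norm (x - q))\<^sup>2)"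
  have bdd: "bdd_below ((\<lambda>q. (norm (x - q))\<^sup>2) ` S)"
    by (rule bdd_belowI[of _ 0]) auto
  have D_le: "D \<le> (norm (x - q))\<^sup>2" if "q \<in> S" for q
    unfolding D_def using bdd that by (rule cINF_lower)
  define T where "T n = S \<inter> {q. (norm (x - q))\<^sup>2 \<le> D + 1 / real (Suc n)}" for n
  have diam: "(dist p q)\<^sup>2 \<le> 4 / real (Suc n)" if "p \<in> T n" "q \<in> T n" for p q n
  proof -
    let ?m = "(1/2) *\<^sub>R p + (1/2) *\<^sub>R q"
    have "?m \<in> S"
      using that \<open>convex S\<close> by (intro convexD) (auto simp: T_def)
    moreover have "(dist p q)\<^sup>2 = 2 * (norm (x - p))\<^sup>2 + 2 * (norm (x - q))\<^sup>2 - 4 * (norm (x - ?m))\<^sup>2"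
      by (simp add: dist_norm power2_norm_eq_inner inner_diff_left inner_diff_right
          inner_add_left inner_add_right inner_commute algebra_simps)
    moreover have "(norm (x - p))\<^sup>2 \<le> D + 1 / real (Suc n)" "(norm (x - q))\<^sup>2 \<le> D + 1 / real (Suc n)"
      using that by (auto simp: T_def)
    ultimately show ?thesis
      using D_le[of ?m] by linarith
  qed
  obtain p where p: "\<And>n. p \<in> T n"
  proof (rule decreasing_closed_nest[of T])
    show "closed (T n)" for n
      unfolding T_def using \<open>closed S\<close>
      by (intro closed_Int closed_Collect_le continuous_intros)
    show "T n \<noteq> {}" for n
    proof -
      have "\<exists>q\<in>S. (norm (x - q))\<^sup>2 < D + 1 / real (Suc n)"
        unfolding D_def using cINF_less_iff[OF \<open>S \<noteq> {}\<close> bdd]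
        by (metis D_def less_add_same_cancel1 of_nat_0_less_iff zero_less_Suc zero_less_divide_1_iff)
      then show ?thesis
        unfolding T_def by (blast intro: less_imp_le)
    qed
    show "T n \<subseteq> T m" if "m \<le> n" for m n
    proof -
      have "1 / real (Suc n) \<le> 1 / real (Suc m)"
        using that by (simp add: frac_le)
      then show ?thesis
        unfolding T_def by auto
    qed
    show "\<exists>n. \<forall>p\<in>T n. \<forall>q\<in>T n. dist p q < e" if "e > 0" for e
    proof -
      obtain n where n: "inverse (real (Suc n)) < e\<^sup>2 / 4"
        using reals_Archimedean[of "e\<^sup>2 / 4"] \<open>e > 0\<close> by auto
      have "dist p q < e" if "p \<in> T n" "q \<in> T n" for p q
      proof (rule power2_less_imp_less)
        show "(dist p q)\<^sup>2 < e\<^sup>2"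
          using diam[OF that] n divide_inverse[of 4 "real (Suc n)"] by linarith
      qed (use \<open>e > 0\<close> in simp)
      then show ?thesis by blast
    qed
  qed blast
  have "(norm (x - p))\<^sup>2 \<le> D"
  proof (rule LIMSEQ_le_const)
    show "(\<lambda>n. D + 1 / real (Suc n)) \<longlonglongrightarrow> D"
      using tendsto_add[OF tendsto_const LIMSEQ_inverse_real_of_nat, of D]
      by (simp add: divide_inverse)
    show "\<exists>N. \<forall>n\<ge>N. (norm (x - p))\<^sup>2 \<le> D + 1 / real (Suc n)"
      using p by (auto simp: T_def)
  qed
  then have "(norm (x - p))\<^sup>2 \<le> (norm (x - q))\<^sup>2" if "q \<in> S" for q
    using D_le[OF that] by (rule order_trans)
  then have "dist x p \<le> dist x q" if "q \<in> S" for q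
    unfolding dist_norm by (rule power2_le_imp_le[OF _ norm_ge_zero]) (fact that)
  moreover have "p \<in> S"
    using p[of 0] unfolding T_def by (rule IntD1)
  ultimately show ?thesis by blast
qed

lemma metric_projection_nearest:
  fixes S :: "'a::{real_inner, complete_space} set"
  assumes "closed S" "convex S" "S \<noteq> {}"
  shows "metric_projection S x \<in> S \<and> (\<forall>q\<in>S. dist x (metric_projection S x) \<le> dist x q)"
  unfolding metric_projection_def
proof (rule theI')
  show "\<exists>!p. p \<in> S \<and> (\<forall>q\<in>S. dist x p \<le> dist x q)"
    using nearest_point_exists[OF assms, of x] any_closest_point_unique[OF assms(2,1)] by blast
qed

lemma metric_projection_in:
  fixes S :: "'a::{real_inner, complete_space} set"
  assumes "closed S" "convex S" "S \<noteq> {}"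
  shows "metric_projection S x \<in> S"
  using metric_projection_nearest[OF assms] by blast

lemma metric_projection_obtuse:
  fixes S :: "'a::{real_inner, complete_space} set"
  assumes "closed S" "convex S" "q \<in> S"
  shows "inner (x - metric_projection S x) (q - metric_projection S x) \<le> 0"
  using assms metric_projection_nearest[of S x]
  by (intro any_closest_point_dot[of S]) auto

lemma metric_projection_pythagoras:
  fixes S :: "'a::{real_inner, complete_space} set"
  assumes "closed S" "convex S" "q \<in> S"
  shows "(norm (metric_projection S x - q))\<^sup>2 + (norm (x - metric_projection S x))\<^sup>2 \<le> (norm (x - q))\<^sup>2"
proof -
  let ?p = "metric_projection S x"
  have "(norm (x - q))\<^sup>2 = (norm (?p - q))\<^sup>2 + (norm (x - ?p))\<^sup>2 - 2 * inner (x - ?p) (q - ?p)"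
    by (simp add: power2_norm_eq_inner inner_diff_left inner_diff_right inner_commute algebra_simps)
  then show ?thesis
    using metric_projection_obtuse[OF assms, of x] by linarith
qed

lemma strict_separation:
  fixes S :: "'a::{real_inner, complete_space} set"
  assumes "closed S" "convex S" "w \<notin> S"
  shows "\<exists>y b. (\<forall>a\<in>S. inner a y < b) \<and> b < inner w y"
proof (cases "S = {}")
  case True
  then show ?thesis
    by (intro exI[of _ 0] exI[of _ "-1"]) auto
next
  case False
  define p where "p = metric_projection S w"
  have "p \<in> S"
    unfolding p_def using assms False by (intro metric_projection_in)
  then have "inner (w - p) (w - p) > 0"
    using assms(3) by auto
  then have gap: "inner p (w - p) < inner w (w - p)"
    by (simp add: inner_diff_left)
  have "inner a (w - p) \<le> inner p (w - p)" if "a \<in> S" for a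
    using metric_projection_obtuse[OF assms(1,2) that, of w, folded p_def]
    by (simp add: inner_diff_right inner_diff_left inner_commute)
  then show ?thesis
    using gap by (intro exI[of _ "w - p"] exI[of _ "(inner p (w - p) + inner w (w - p)) / 2"]) fastforce
qed

section \<open>Weak convergence and weak sequential compactness\<close>

lemma orthogonal_decomposition:
  fixes G :: "'a::{real_inner, complete_space} set"
  assumes "closed G" "subspace G"
  shows "\<exists>p\<in>G. \<forall>g\<in>G. inner (y - p) g = 0"
proof -
  let ?p = "metric_projection G y"
  have conv: "convex G" and ne: "G \<noteq> {}"
    using assms subspace_imp_convex subspace_0 by blast+
  have p: "?p \<in> G"
    using assms(1) conv ne by (rule metric_projection_in)
  have "inner (y - ?p) g = 0" if "g \<in> G" for g
  proof -
    have "?p + g \<in> G" "?p - g \<in> G"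
      using p that assms(2) by (auto intro: subspace_add subspace_diff)
    from this[THEN metric_projection_obtuse[OF assms(1) conv, of _ y]] show ?thesis
      by simp
  qed
  with p show ?thesis by blast
qed

lemma riesz_representation:
  fixes f :: "'a::{real_inner, complete_space} \<Rightarrow> real"
  assumes "bounded_linear f"
  shows "\<exists>y. \<forall>x. f x = inner x y"
proof (cases "\<forall>x. f x = 0")
  case True
  then show ?thesis by (intro exI[of _ 0]) simp
next
  case False
  then obtain e where e: "f e \<noteq> 0" by blast
  interpret f: bounded_linear f by fact
  define G where "G = {x. f x = 0}"
  have "closed G"
    unfolding G_def by (intro closed_Collect_eq f.continuous_on continuous_intros)
  moreover have "subspace G"
    unfolding G_def subspace_def by (simp add: f.zero f.add f.scaleR)
  ultimately obtain p where p: "p \<in> G" "\<And>g. g \<in> G \<Longrightarrow> inner (e - p) g = 0"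
    using orthogonal_decomposition by blast
  define u where "u = e - p"
  have fu: "f u = f e"
    using p(1) by (simp add: u_def f.diff G_def)
  then have "u \<noteq> 0"
    using e f.zero by auto
  have "f x = inner x ((f u / inner u u) *\<^sub>R u)" for x
  proof -
    have "x - (f x / f u) *\<^sub>R u \<in> G"
      using fu e by (simp add: G_def f.diff f.scaleR)
    then have "inner u (x - (f x / f u) *\<^sub>R u) = 0"
      unfolding u_def by (rule p(2))
    then have "inner u x = (f x / f u) * inner u u"
      by (simp add: inner_diff_right)
    then show ?thesis
      using \<open>u \<noteq> 0\<close> fu e by (simp add: inner_commute field_simps)
  qed
  then show ?thesis by blast
qed

lemma weakly_converges_iff_inner:
  fixes x :: "nat \<Rightarrow> 'a::{real_inner, complete_space}"
  shows "weakly_converges_to x l \<longleftrightarrow> (\<forall>y. (\<lambda>n. inner (x n) y) \<longlonglongrightarrow> inner l y)"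
proof
  assume "weakly_converges_to x l"
  then show "\<forall>y. (\<lambda>n. inner (x n) y) \<longlonglongrightarrow> inner l y"
    unfolding weakly_converges_to_def using bounded_linear_inner_left by blast
next
  assume lim: "\<forall>y. (\<lambda>n. inner (x n) y) \<longlonglongrightarrow> inner l y"
  show "weakly_converges_to x l"
    unfolding weakly_converges_to_def
  proof (intro allI impI)
    fix f :: "'a \<Rightarrow> real"
    assume "bounded_linear f"
    then obtain y where "\<And>z. f z = inner z y"
      using riesz_representation by blast
    then show "(\<lambda>n. f (x n)) \<longlonglongrightarrow> f l"
      using lim by simp
  qed
qed

text \<open>Tychonoff's theorem for countably many coordinates replaces a diagonal argument: it makes
  the inner products with every term of the sequence itself converge along one subsequence. The
  vectors with this property form a closed subspace, and vectors orthogonal to it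
  have inner product 0 with every term, so it is the whole space. The Riesz representation
  of the limiting functional is the weak limit.\<close>
lemma bounded_imp_weakly_convergent_subseq:
  fixes x :: "nat \<Rightarrow> 'a::{real_inner, complete_space}"
  assumes bound: "\<And>n. norm (x n) \<le> M"
  shows "\<exists>r l. strict_mono r \<and> weakly_converges_to (x \<circ> r) l"
proof -
  have M: "0 \<le> M"
    using bound[of 0] norm_ge_zero order_trans by blast
  define F where "F n = (\<lambda>m. inner (x n) (x m))" for n
  let ?C = "UNIV \<rightarrow>\<^sub>E {-(M * M)..M * M} :: (nat \<Rightarrow> real) set"
  have "compactin (product_topology (\<lambda>_. euclidean) UNIV) ?C"
    by (simp add: compactin_PiE)
  then have "seq_compact ?C"
    by (simp add: euclidean_product_topology compact_imp_seq_compact)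
  moreover have "\<forall>n. F n \<in> ?C"
  proof
    fix n
    have "\<bar>inner (x n) (x m)\<bar> \<le> M * M" for m
      using Cauchy_Schwarz_ineq2[of "x n" "x m"] mult_mono[OF bound[of n] bound[of m] M] by fastforce
    then show "F n \<in> ?C"
      unfolding F_def by (auto simp: abs_le_iff minus_le_iff)
  qed
  ultimately obtain L r where r: "strict_mono r" and L: "(F \<circ> r) \<longlonglongrightarrow> L"
    unfolding seq_compact_def by metis
  define G where "G = {y. convergent (\<lambda>j. inner (x (r j)) y)}"
  have x_in: "x m \<in> G" for m
  proof -
    have "continuous_on UNIV (\<lambda>g :: nat \<Rightarrow> real. g m)"
      by (rule continuous_on_product_coordinates)
    then have "(\<lambda>j. (F \<circ> r) j m) \<longlonglongrightarrow> L m"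
      using L by (rule continuous_on_tendsto_compose) auto
    then show ?thesis
      unfolding G_def F_def convergent_def by auto
  qed
  have "subspace G"
    unfolding G_def subspace_def
    by (auto simp: inner_add_right intro: convergent_add convergent_mult convergent_const)
  moreover have "closed G"
    unfolding closed_sequential_limits
  proof (intro allI impI, elim conjE)
    fix g y
    assume gG: "\<forall>n. g n \<in> G" and gy: "g \<longlonglongrightarrow> y"
    have "Cauchy (\<lambda>j. inner (x (r j)) y)"
    proof (rule CauchyI)
      fix e :: real
      assume "0 < e"
      then have "0 < e / (4 * (M + 1))"
        using M by simp
      then obtain k where k: "norm (g k - y) < e / (4 * (M + 1))"
        using gy LIMSEQ_iff by blast
      have "Cauchy (\<lambda>j. inner (x (r j)) (g k))"
        using gG by (simp add: G_def Cauchy_convergent_iff)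
      then obtain N where N: "\<And>m n. m \<ge> N \<Longrightarrow> n \<ge> N \<Longrightarrow>
          norm (inner (x (r m)) (g k) - inner (x (r n)) (g k)) < e / 2"
        using CauchyD[of _ "e / 2"] \<open>0 < e\<close> by (metis half_gt_zero)
      have small: "\<bar>inner (x j) (y - g k)\<bar> \<le> e / 4" for j
      proof -
        have "\<bar>inner (x j) (y - g k)\<bar> \<le> norm (x j) * norm (y - g k)"
          by (rule Cauchy_Schwarz_ineq2)
        also have "\<dots> \<le> (M + 1) * (e / (4 * (M + 1)))"
          using bound[of j] k M by (intro mult_mono) (auto simp: norm_minus_commute)
        also have "\<dots> = e / 4"
          using M by (simp add: divide_simps)
        finally show ?thesis .
      qed
      have "norm (inner (x (r m)) y - inner (x (r n)) y) < e" if "m \<ge> N" "n \<ge> N" for m n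
        using N[OF that] small[of "r m"] small[of "r n"] unfolding inner_diff_right real_norm_def
        by linarith
      then show "\<exists>N. \<forall>m\<ge>N. \<forall>n\<ge>N. norm (inner (x (r m)) y - inner (x (r n)) y) < e"
        by blast
    qed
    then show "y \<in> G"
      by (simp add: G_def Cauchy_convergent_iff)
  qed
  ultimately have conv: "convergent (\<lambda>j. inner (x (r j)) y)" for y
  proof -
    obtain p where p: "p \<in> G" "\<And>g. g \<in> G \<Longrightarrow> inner (y - p) g = 0"
      using orthogonal_decomposition \<open>closed G\<close> \<open>subspace G\<close> by blast
    have "inner (x (r j)) y = inner (x (r j)) p" for j
      using p(2)[OF x_in[of "r j"]] by (simp add: inner_diff_left inner_commute)
    then show ?thesis
      using p(1) by (simp add: G_def)
  qed
  define f where "f y = lim (\<lambda>j. inner (x (r j)) y)" for y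
  have f: "(\<lambda>j. inner (x (r j)) y) \<longlonglongrightarrow> f y" for y
    unfolding f_def using conv by (simp add: convergent_LIMSEQ_iff)
  have "bounded_linear f"
  proof (rule bounded_linear_intro[where K = M])
    show "f (y + z) = f y + f z" for y z
      using LIMSEQ_unique[OF f[of "y + z"]] tendsto_add[OF f[of y] f[of z]]
      by (simp add: inner_add_right)
    show "f (c *\<^sub>R y) = c *\<^sub>R f y" for c y
      using LIMSEQ_unique[OF f[of "c *\<^sub>R y"]] tendsto_mult_left[OF f[of y], of c] by simp
    show "norm (f y) \<le> norm y * M" for y
    proof (rule LIMSEQ_le_const2[OF tendsto_norm[OF f[of y]]], intro exI allI impI)
      fix j :: nat
      have "norm (inner (x (r j)) y) \<le> norm (x (r j)) * norm y"
        by (simp add: Cauchy_Schwarz_ineq2)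
      also have "\<dots> \<le> norm y * M"
        using mult_right_mono[OF bound[of "r j"], of "norm y"] by (simp add: mult.commute)
      finally show "norm (inner (x (r j)) y) \<le> norm y * M" .
    qed
  qed
  then obtain l where "\<And>y. f y = inner y l"
    using riesz_representation by blast
  then have "weakly_converges_to (x \<circ> r) l"
    unfolding weakly_converges_iff_inner using f by (simp add: inner_commute)
  with r show ?thesis by blast
qed

lemma filterlim_imp_strict_mono_subseq:
  fixes s :: "nat \<Rightarrow> nat"
  assumes "filterlim s at_top sequentially"
  shows "\<exists>q :: nat \<Rightarrow> nat. strict_mono q \<and> strict_mono (s \<circ> q)"
proof -
  have "\<exists>b. a < b \<and> s a < s b" for a
  proof -
    have "eventually (\<lambda>b. Suc (s a) \<le> s b) sequentially"
      using assms unfolding filterlim_at_top by blast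
    then have "eventually (\<lambda>b. a < b \<and> s a < s b) sequentially"
      using eventually_gt_at_top[of a] by eventually_elim simp
    then show ?thesis
      using eventually_happens sequentially_bot by blast
  qed
  then have "\<exists>q. \<forall>n. True \<and> (q n < q (Suc n) \<and> s (q n) < s (q (Suc n)))"
    by (intro dependent_nat_choice) auto
  then show ?thesis
    by (auto simp: strict_mono_Suc_iff)
qed

lemma weakly_converges_subseq:
  assumes "weakly_converges_to x l" "strict_mono r"
  shows "weakly_converges_to (x \<circ> r) l"
  using assms LIMSEQ_subseq_LIMSEQ unfolding weakly_converges_to_def comp_def by fastforce

text \<open>Indices that merely tend to infinity, possibly with repetitions, give a partial weak limit.\<close>
lemma partial_weak_limits_filterlimI:
  assumes "filterlim s at_top sequentially" "weakly_converges_to (x \<circ> s) v"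
  shows "v \<in> partial_weak_limits x"
proof -
  obtain q :: "nat \<Rightarrow> nat" where "strict_mono q" "strict_mono (s \<circ> q)"
    using filterlim_imp_strict_mono_subseq[OF assms(1)] by blast
  then show ?thesis
    unfolding partial_weak_limits_def using weakly_converges_subseq[OF assms(2)]
    by (metis (mono_tags, lifting) comp_assoc mem_Collect_eq)
qed


section \<open>Random products of projections\<close>

locale random_projections =
  fixes A :: "nat \<Rightarrow> 'a::{real_inner, complete_space} set"
    and K :: nat
    and i :: "nat \<Rightarrow> nat"
    and x :: "nat \<Rightarrow> 'a"
  assumes closed: "k \<in> {1..K} \<Longrightarrow> closed (A k)"
    and convex: "k \<in> {1..K} \<Longrightarrow> convex (A k)"
    and Inter_eq: "(\<Inter>k\<in>{1..K}. A k) = {0}"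
    and index_range: "n \<ge> 1 \<Longrightarrow> i n \<in> {1..K}"
    and infinitely_often: "k \<in> {1..K} \<Longrightarrow> infinite {n. n \<ge> 1 \<and> i n = k}"
    and step: "n \<ge> 1 \<Longrightarrow> x n = metric_projection (A (i n)) (x (n - 1))"
begin

lemma zero_in: "k \<in> {1..K} \<Longrightarrow> 0 \<in> A k"
  using Inter_eq by blast

lemma step_in: "n \<ge> 1 \<Longrightarrow> x n \<in> A (i n)"
  using step[of n] index_range[of n] closed convex zero_in metric_projection_in by (metis empty_iff)

lemma step_pythagoras:
  assumes "z \<in> A (i (Suc n))"
  shows "(norm (x (Suc n) - z))\<^sup>2 + (norm (x n - x (Suc n)))\<^sup>2 \<le> (norm (x n - z))\<^sup>2"
  using metric_projection_pythagoras[OF closed convex assms, of "x n"] index_range[of "Suc n"]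
    step[of "Suc n"] by simp

lemma fejer_monotone:
  assumes "m \<le> n" "\<And>l. m < l \<Longrightarrow> l \<le> n \<Longrightarrow> z \<in> A (i l)"
  shows "norm (x n - z) \<le> norm (x m - z)"
  using assms
proof (induction rule: dec_induct)
  case (step n)
  have "(norm (x (Suc n) - z))\<^sup>2 \<le> (norm (x n - z))\<^sup>2"
    using step_pythagoras[of z n] step.prems[of "Suc n"] step.hyps
    by (smt (verit) le_SucI le_imp_less_Suc order_refl zero_le_power2)
  then have "norm (x (Suc n) - z) \<le> norm (x n - z)"
    by (rule power2_le_imp_le) simp
  moreover have "norm (x n - z) \<le> norm (x m - z)"
    using step by simp
  ultimately show ?case by simp
qed simp

lemma norm_antimono: "m \<le> n \<Longrightarrow> norm (x n) \<le> norm (x m)"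
  using fejer_monotone[of m n 0] zero_in index_range by simp

lemma norm_square_convergent: "convergent (\<lambda>n. (norm (x n))\<^sup>2)"
proof -
  have "decseq (\<lambda>n. (norm (x n))\<^sup>2)"
    by (auto simp: decseq_def intro: power_mono norm_antimono)
  then obtain L where "(\<lambda>n. (norm (x n))\<^sup>2) \<longlonglongrightarrow> L"
    using decseq_convergent[of _ 0] zero_le_power2 by metis
  then show ?thesis
    by (auto simp: convergent_def)
qed

lemma norm_square_diff_tendsto_0:
  assumes "filterlim s at_top sequentially" "filterlim t at_top sequentially"
  shows "(\<lambda>j. (norm (x (s j)))\<^sup>2 - (norm (x (t j)))\<^sup>2) \<longlonglongrightarrow> 0"
proof -
  obtain L where L: "(\<lambda>n. (norm (x n))\<^sup>2) \<longlonglongrightarrow> L"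
    using norm_square_convergent by (auto simp: convergent_def)
  show ?thesis
    using tendsto_diff[OF filterlim_compose[OF L assms(1)] filterlim_compose[OF L assms(2)]] by simp
qed

lemma steps_tendsto_0: "(\<lambda>n. x n - x (Suc n)) \<longlonglongrightarrow> 0"
proof -
  have "(\<lambda>n. (norm (x n - x (Suc n)))\<^sup>2) \<longlonglongrightarrow> 0"
  proof (rule tendsto_sandwich[OF _ _ tendsto_const])
    show "(\<lambda>n. (norm (x n))\<^sup>2 - (norm (x (Suc n)))\<^sup>2) \<longlonglongrightarrow> 0"
      by (intro norm_square_diff_tendsto_0 filterlim_ident filterlim_Suc)
    show "\<forall>\<^sub>F n in sequentially.
        (norm (x n - x (Suc n)))\<^sup>2 \<le> (norm (x n))\<^sup>2 - (norm (x (Suc n)))\<^sup>2"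
      using step_pythagoras[of 0] zero_in index_range by (auto simp: algebra_simps)
  qed auto
  then show ?thesis
    by (simp add: tendsto_norm_zero_iff)
qed

lemma weakly_convergent_subseq:
  fixes s :: "nat \<Rightarrow> nat"
  shows "\<exists>q v. strict_mono q \<and> weakly_converges_to (x \<circ> s \<circ> q) v"
  using bounded_imp_weakly_convergent_subseq[of "x \<circ> s" "norm (x 0)"] norm_antimono by simp

text \<open>The distance to a common point of the sets used between the times \<open>s j\<close> and \<open>t j\<close> does not
  increase. In the squared form of this inequality the squared norms of the iterates have a
  common limit, so only the inner products survive.\<close>
lemma block_inner_mono:
  assumes "filterlim s at_top sequentially" "filterlim t at_top sequentially"
    and "weakly_converges_to (x \<circ> s) w" "weakly_converges_to (x \<circ> t) v"
    and "\<And>j. s j \<le> t j" "\<And>j l. s j < l \<Longrightarrow> l \<le> t j \<Longrightarrow> z \<in> A (i l)"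
  shows "inner w z \<le> inner v z"
proof -
  have "(\<lambda>j. inner (x (s j)) z) \<longlonglongrightarrow> inner w z" "(\<lambda>j. inner (x (t j)) z) \<longlonglongrightarrow> inner v z"
    using assms(3,4) by (auto simp: weakly_converges_iff_inner)
  then have lim: "(\<lambda>j. ((norm (x (s j)))\<^sup>2 - (norm (x (t j)))\<^sup>2)
      - 2 * (inner (x (s j)) z - inner (x (t j)) z)) \<longlonglongrightarrow> 0 - 2 * (inner w z - inner v z)"
    by (intro tendsto_diff tendsto_mult_left norm_square_diff_tendsto_0 assms(1,2))
  have "0 \<le> ((norm (x (s j)))\<^sup>2 - (norm (x (t j)))\<^sup>2)
      - 2 * (inner (x (s j)) z - inner (x (t j)) z)" for j
  proof -
    have "norm (x (t j) - z) \<le> norm (x (s j) - z)"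
      using assms(5,6) by (rule fejer_monotone)
    then have "(norm (x (t j) - z))\<^sup>2 \<le> (norm (x (s j) - z))\<^sup>2"
      by (simp add: power_mono)
    then show ?thesis
      by (simp add: power2_norm_eq_inner inner_diff_left inner_diff_right inner_commute algebra_simps)
  qed
  then have "0 \<le> 0 - 2 * (inner w z - inner v z)"
    using LIMSEQ_le_const[OF lim] by blast
  then show ?thesis by simp
qed

definition active :: "'a \<Rightarrow> nat set" where
  "active w = {k \<in> {1..K}. w \<in> A k}"

text \<open>A single scalar serves all active sets at once, since these sets are convex and contain 0.\<close>
lemma active_internal:
  assumes "\<forall>k\<in>{1..K}. zero_weak_internal (A k)"
  shows "\<exists>c>0. \<forall>k\<in>active z. - (c *\<^sub>R z) \<in> A k"
proof -
  have "\<forall>k\<in>active z. \<exists>c>0. - (c *\<^sub>R z) \<in> A k"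
    using assms by (auto simp: active_def zero_weak_internal_def)
  then obtain c where c: "\<And>k. k \<in> active z \<Longrightarrow> c k > 0 \<and> - (c k *\<^sub>R z) \<in> A k"
    by metis
  define m where "m = Min (insert 1 (c ` active z))"
  have fin: "finite (insert 1 (c ` active z))"
    by (simp add: active_def)
  have "m > 0"
    unfolding m_def using fin c by (subst Min_gr_iff) auto
  moreover have "- (m *\<^sub>R z) \<in> A k" if k: "k \<in> active z" for k
  proof -
    have "m \<le> c k"
      unfolding m_def using fin k by (intro Min_le) auto
    have "k \<in> {1..K}"
      using k by (simp add: active_def)
    then have "(m / c k) *\<^sub>R (- (c k *\<^sub>R z)) + (1 - m / c k) *\<^sub>R 0 \<in> A k"
      using c[OF k] \<open>m > 0\<close> \<open>m \<le> c k\<close> zero_in convex by (intro convexD) auto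
    then show ?thesis
      using c[OF k] by simp
  qed
  ultimately show ?thesis by blast
qed

text \<open>The inequality for \<open>z\<close> is reversed by applying it to a negative multiple of \<open>z\<close>, which lies in
  the same sets.\<close>
lemma block_inner_eq:
  assumes "\<forall>k\<in>{1..K}. zero_weak_internal (A k)"
    and "filterlim s at_top sequentially" "filterlim t at_top sequentially"
    and "weakly_converges_to (x \<circ> s) w" "weakly_converges_to (x \<circ> t) v"
    and "\<And>j. s j \<le> t j" "\<And>j l. s j < l \<Longrightarrow> l \<le> t j \<Longrightarrow> i l \<in> active z"
  shows "inner w z = inner v z"
proof (rule antisym)
  show "inner w z \<le> inner v z"
    using assms(7) by (intro block_inner_mono[OF assms(2-6)]) (auto simp: active_def)
  obtain c where c: "c > 0" "\<And>k. k \<in> active z \<Longrightarrow> - (c *\<^sub>R z) \<in> A k"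
    using active_internal[OF assms(1)] by blast
  have "inner w (- (c *\<^sub>R z)) \<le> inner v (- (c *\<^sub>R z))"
    using assms(7) c(2) by (intro block_inner_mono[OF assms(2-6)]) blast
  then show "inner v z \<le> inner w z"
    using c(1) by simp
qed

text \<open>Here \<open>t\<close> is the time just before the iterates, starting at the time \<open>s\<close>, first reach a hyperplane
  that separates an inactive set from \<open>w\<close>. The positions at \<open>t\<close> are still on the side of \<open>w\<close>, which
  keeps \<open>v\<close> out of every inactive set; the positions at the next step have the same weak
  limit and are not on that side, which makes \<open>v\<close> different from \<open>w\<close>.\<close>
lemma partial_weak_limit_exit:
  assumes w: "w \<in> partial_weak_limits x" and ne: "active w \<noteq> {1..K}"
  obtains s t v where "filterlim s at_top sequentially" "filterlim t at_top sequentially"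
    "weakly_converges_to (x \<circ> s) w" "weakly_converges_to (x \<circ> t) v"
    "\<And>j. s j \<le> t j" "\<And>j l. s j < l \<Longrightarrow> l \<le> t j \<Longrightarrow> i l \<in> active w"
    "active v \<subseteq> active w" "v \<noteq> w"
proof -
  define J where "J = {1..K} - active w"
  have J: "finite J" "J \<noteq> {}" "J \<subseteq> {1..K}"
    using ne by (auto simp: J_def active_def)
  have "\<exists>y b. (\<forall>a\<in>A k. inner a y < b) \<and> b < inner w y" if "k \<in> J" for k
    using that closed convex by (intro strict_separation) (auto simp: J_def active_def)
  then obtain y b where yb: "\<And>k a. k \<in> J \<Longrightarrow> a \<in> A k \<Longrightarrow> inner a (y k) < b k"
    "\<And>k. k \<in> J \<Longrightarrow> b k < inner w (y k)"
    by metis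
  obtain r where r: "strict_mono r" "weakly_converges_to (x \<circ> r) w"
    using w by (auto simp: partial_weak_limits_def)
  have "eventually (\<lambda>j. \<forall>k\<in>J. b k < inner (x (r j)) (y k)) sequentially"
    using J(1)
  proof (rule eventually_ball_finite, intro ballI)
    fix k
    assume "k \<in> J"
    have "(\<lambda>j. inner (x (r j)) (y k)) \<longlonglongrightarrow> inner w (y k)"
      using r(2) by (simp add: weakly_converges_iff_inner)
    then show "eventually (\<lambda>j. b k < inner (x (r j)) (y k)) sequentially"
      using yb(2)[OF \<open>k \<in> J\<close>] by (rule order_tendstoD)
  qed
  then obtain N where N: "\<And>j k. j \<ge> N \<Longrightarrow> k \<in> J \<Longrightarrow> b k < inner (x (r j)) (y k)"
    by (auto simp: eventually_sequentially)
  \<comment> \<open>Dropping finitely many terms puts every starting position on the side of the limit.\<close>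
  define s where "s j = r (j + N)" for j
  define crossed where "crossed l \<longleftrightarrow> (\<exists>k\<in>J. inner (x l) (y k) \<le> b k)" for l
  have s_mono: "strict_mono s"
    using r(1) by (simp add: s_def strict_mono_def)
  have s_weak: "weakly_converges_to (x \<circ> s) w"
    using weakly_converges_subseq[OF r(2), of "\<lambda>j. j + N"]
    by (simp add: s_def comp_def strict_mono_def)
  have not_crossed_s: "\<not> crossed (s j)" for j
    using N[of "j + N"] by (force simp: crossed_def s_def not_le)
  have crossed_J: "crossed l" if "l \<ge> 1" "i l \<in> J" for l
    using that step_in[of l] yb(1) by (force simp: crossed_def)
  have ex_crossed: "\<exists>l\<ge>m. crossed l" for m
  proof -
    obtain k where "k \<in> J"
      using J(2) by blast
    then have "infinite {n. n \<ge> 1 \<and> i n = k}"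
      using J(3) infinitely_often by blast
    then obtain n where "n > m" "n \<ge> 1" "i n = k"
      unfolding infinite_nat_iff_unbounded by blast
    then show ?thesis
      using crossed_J[of n] \<open>k \<in> J\<close> less_imp_le by blast
  qed
  define L where "L j = (LEAST l. s j \<le> l \<and> crossed l)" for j
  have L: "s j \<le> L j" "crossed (L j)" for j
    using LeastI_ex[OF ex_crossed[of "s j", simplified]] by (auto simp: L_def)
  have L_least: "\<not> crossed l" if "s j \<le> l" "l < L j" for j l
    using not_less_Least[of l "\<lambda>l. s j \<le> l \<and> crossed l"] that by (auto simp: L_def)
  have L_gt: "s j < L j" for j
    using L[of j] not_crossed_s[of j] by (cases "s j = L j") auto
  define t where "t j = L j - 1" for j
  have L_eq: "L j = Suc (t j)" for j
    using L_gt[of j] by (simp add: t_def)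
  have st: "s j \<le> t j" for j
    using L_gt[of j] by (simp add: L_eq)
  obtain q v where q: "strict_mono q" and v: "weakly_converges_to (x \<circ> t \<circ> q) v"
    using weakly_convergent_subseq by blast
  have sq_lim: "filterlim (s \<circ> q) at_top sequentially"
    using strict_mono_o[OF s_mono q] by (rule filterlim_subseq)
  have tq_lim: "filterlim (t \<circ> q) at_top sequentially"
    using sq_lim by (rule filterlim_at_top_mono) (simp add: st)
  have t_lim: "(\<lambda>j. inner (x (t (q j))) z) \<longlonglongrightarrow> inner v z" for z
    using v by (simp add: weakly_converges_iff_inner)
  have L_lim: "(\<lambda>j. inner (x (L (q j))) z) \<longlonglongrightarrow> inner v z" for z
  proof -
    have "(\<lambda>j. inner (x (t (q j)) - x (Suc (t (q j)))) z) \<longlonglongrightarrow> inner 0 z"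
      using filterlim_compose[OF steps_tendsto_0 tq_lim] by (intro tendsto_inner tendsto_const) simp
    from tendsto_diff[OF t_lim[of z] this] show ?thesis
      by (simp add: L_eq inner_diff_left)
  qed
  show ?thesis
  proof
    show "filterlim (s \<circ> q) at_top sequentially" "filterlim (t \<circ> q) at_top sequentially"
      by fact+
    show "weakly_converges_to (x \<circ> (s \<circ> q)) w"
      using weakly_converges_subseq[OF s_weak q] by (simp add: comp_assoc)
    show "weakly_converges_to (x \<circ> (t \<circ> q)) v"
      using v by (simp add: comp_assoc)
    show "(s \<circ> q) j \<le> (t \<circ> q) j" for j
      using st by simp
    show "i l \<in> active w" if "(s \<circ> q) j < l" "l \<le> (t \<circ> q) j" for j l
    proof -
      have "\<not> crossed l"
        using that by (intro L_least[of "q j"]) (auto simp: L_eq)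
      then have "i l \<notin> J"
        using crossed_J[of l] that(1) by linarith
      then show ?thesis
        using index_range[of l] that(1) by (auto simp: J_def)
    qed
    show "active v \<subseteq> active w"
    proof
      fix k
      assume k: "k \<in> active v"
      show "k \<in> active w"
      proof (rule ccontr)
        assume "k \<notin> active w"
        then have "k \<in> J"
          using k by (simp add: J_def active_def)
        have "b k \<le> inner (x (t (q j))) (y k)" for j
          using L_least[of "q j" "t (q j)"] st \<open>k \<in> J\<close> by (force simp: crossed_def L_eq)
        then have "b k \<le> inner v (y k)"
          using LIMSEQ_le_const[OF t_lim] by blast
        then show False
          using yb(1)[OF \<open>k \<in> J\<close>, of v] k by (simp add: active_def)
      qed
    qed
    show "v \<noteq> w"
    proof
      assume "v = w"
      have "eventually (\<lambda>j. \<forall>k\<in>J. b k < inner (x (L (q j))) (y k)) sequentially"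
        using J(1) order_tendstoD(1)[OF L_lim] yb(2) \<open>v = w\<close>
        by (intro eventually_ball_finite ballI) auto
      then obtain j where "\<forall>k\<in>J. b k < inner (x (L (q j))) (y k)"
        using eventually_happens by fastforce
      then show False
        using L(2)[of "q j"] by (force simp: crossed_def)
    qed
  qed
qed

lemma partial_weak_limits_subset_zero:
  assumes internal: "\<forall>k\<in>{1..K}. zero_weak_internal (A k)"
  shows "partial_weak_limits x \<subseteq> {0}"
proof (cases "partial_weak_limits x = {}")
  case False
  \<comment> \<open>The exit from a neighbourhood of this limit leads to a limit with no more active indices,
    hence with the same ones.\<close>
  then obtain w where w: "w \<in> partial_weak_limits x"
    and min: "\<And>v. v \<in> partial_weak_limits x \<Longrightarrow> card (active w) \<le> card (active v)"
    using ex_has_least_nat[of "\<lambda>v. v \<in> partial_weak_limits x" _ "\<lambda>v. card (active v)"] by blast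
  have fin: "finite (active v)" for v
    by (simp add: active_def)
  have "active w = {1..K}"
  proof (rule ccontr)
    assume "active w \<noteq> {1..K}"
    then obtain s t v where
      block: "filterlim s at_top sequentially" "filterlim t at_top sequentially"
        "weakly_converges_to (x \<circ> s) w" "weakly_converges_to (x \<circ> t) v"
        "\<And>j. s j \<le> t j" "\<And>j l. s j < l \<Longrightarrow> l \<le> t j \<Longrightarrow> i l \<in> active w"
      and v: "active v \<subseteq> active w" "v \<noteq> w"
      using partial_weak_limit_exit[OF w] by metis
    have "v \<in> partial_weak_limits x"
      using block(2,4) by (rule partial_weak_limits_filterlimI)
    then have same: "active v = active w"
      using v(1) min fin by (intro card_seteq) auto
    have "inner w z = inner v z" if "active z = active w" for z
      using block(6) that by (intro block_inner_eq[OF internal block(1-5)]) auto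
    \<comment> \<open>The two choices of the test vector are the two limits themselves.\<close>
    from this[OF same] this[OF refl] have "inner (v - w) (v - w) = 0"
      by (simp add: inner_diff_left inner_diff_right inner_commute)
    then show False
      using v(2) by simp
  qed
  have "v = 0" if "v \<in> partial_weak_limits x" for v
  proof -
    have "active v = {1..K}"
    proof (rule card_seteq)
      show "active v \<subseteq> {1..K}"
        by (auto simp: active_def)
      show "card {1..K} \<le> card (active v)"
        using min[OF that] unfolding \<open>active w = {1..K}\<close> .
    qed simp
    then have "v \<in> (\<Inter>k\<in>{1..K}. A k)"
      by (auto simp: active_def)
    then show ?thesis
      using Inter_eq by blast
  qed
  then show ?thesis by blast
qed simp

lemma partial_weak_limits_eq_zero:
  assumes "\<forall>k\<in>{1..K}. zero_weak_internal (A k)"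
  shows "partial_weak_limits x = {0}"
proof -
  have "partial_weak_limits x \<noteq> {}"
    using weakly_convergent_subseq[of id] by (auto simp: partial_weak_limits_def)
  then show ?thesis
    using partial_weak_limits_subset_zero[OF assms] by blast
qed

lemma weakly_converges_to_unique_limit:
  assumes "partial_weak_limits x = {w}"
  shows "weakly_converges_to x w"
  unfolding weakly_converges_iff_inner
proof (intro allI, rule ccontr)
  fix y
  assume "\<not> (\<lambda>n. inner (x n) y) \<longlonglongrightarrow> inner w y"
  then obtain e where e: "e > 0" "\<And>N. \<exists>n\<ge>N. e \<le> norm (inner (x n) y - inner w y)"
    unfolding LIMSEQ_iff not_all not_imp not_ex not_less by blast
  then obtain s where s: "\<And>N. s N \<ge> N" "\<And>N. e \<le> norm (inner (x (s N)) y - inner w y)"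
    by metis
  obtain q v where q: "strict_mono q" and v: "weakly_converges_to (x \<circ> s \<circ> q) v"
    using weakly_convergent_subseq by blast
  have "filterlim (s \<circ> q) at_top sequentially"
    using filterlim_subseq[OF q] by (rule filterlim_at_top_mono) (simp add: s(1))
  then have "v \<in> partial_weak_limits x"
    using v by (intro partial_weak_limits_filterlimI) (auto simp: comp_assoc)
  then have "v = w"
    using assms by blast
  then have "(\<lambda>j. inner (x (s (q j))) y) \<longlonglongrightarrow> inner w y"
    using v by (simp add: weakly_converges_iff_inner)
  then obtain j where "norm (inner (x (s (q j))) y - inner w y) < e"
    using e(1) unfolding LIMSEQ_iff by blast
  then show False
    using s(2)[of "q j"] by linarith
qed

end

lemma subspace_imp_zero_weak_internal: "subspace S \<Longrightarrow> zero_weak_internal S"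
  unfolding zero_weak_internal_def by (auto intro!: exI[of _ 1] subspace_neg)

theorem corollary2p1:
  fixes A :: "nat \<Rightarrow> 'a::{real_inner, complete_space} set"
    and K :: nat
    and i :: "nat \<Rightarrow> nat"
    and x :: "nat \<Rightarrow> 'a"
  assumes "K \<ge> 2"
    and "\<And>k. k \<in> {1..K} \<Longrightarrow> closed (A k)"
    and "\<And>k. k \<in> {1..K} \<Longrightarrow> convex (A k)"
    and "(\<Inter>k\<in>{1..K}. A k) = {0}"
    and "\<And>n. n \<ge> 1 \<Longrightarrow> i n \<in> {1..K}"
    and "\<And>k. k \<in> {1..K} \<Longrightarrow> infinite {n. n \<ge> 1 \<and> i n = k}"
    and "\<And>n. n \<ge> 1 \<Longrightarrow> x n = metric_projection (A (i n)) (x (n - 1))"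
  shows "((\<forall>k\<in>{1..K}. zero_weak_internal (A k)) \<longrightarrow> partial_weak_limits x = {0})
       \<and> ((\<forall>k\<in>{1..K}. subspace (A k)) \<longrightarrow> (\<exists>l. weakly_converges_to x l))"
proof -
  interpret random_projections A K i x
    by unfold_locales (fact assms)+
  show ?thesis
    using partial_weak_limits_eq_zero weakly_converges_to_unique_limit subspace_imp_zero_weak_internal
    by metis
qed

end
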